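(* Let $k$ be a field of characteristic zero, let $B = k[t]$, and let $f = f_1 \cdots f_r$ with $r \ge 2$, where $f_1, \ldots, f_r \in k[t]$ are irreducible and pairwise coprime polynomials. Let $I = f\,k[t]$, let $A = k + I \subseteq k[t]$, and let $\mathscr{D}_A$ be the ring of $k$-linear differential operators on $A$. Then $\mathscr{D}_A$ is not $R(A)$-locally projective.
   Context: The ring of $k$-linear differential operators (in the sense of Grothendieck) of a commutative $k$-algebra $A$ is the subalgebra $\mathscr{D}_A = \bigcup_{n \ge 0} \mathscr{D}_A^{n} \subseteq \operatorname{End}_k(A)$, where $\mathscr{D}_A^{-1} = 0$ and, for $n \ge 0$, $\mathscr{D}_A^{n} = \{ D \in \operatorname{End}_k(A) : [D, a] \in \mathscr{D}_A^{n-1} \text{ for all } a \in A \}$; here $a \in A$ is identified with the multiplication operator $b \mapsto ab$, so $A \subseteq \mathscr{D}_A$. For $D \in \mathscr{D}_A$ and $a \in A$, $D(a) \in A$ denotes the value of $D$ at $a$. For $D \in \mathscr{D}_A$, let $\Psi_D \colon A \otimes_k \mathscr{D}_A \to \mathscr{D}_A$ be the $k$-linear map given by $\Psi_D(a \otimes D') = D(a) D'$ (the composition of $D'$ followed by multiplication by $D(a)$). $\mathscr{D}_A$ is called $R(A)$-locally projective if for all $D \in \mathscr{D}_A$ we have $D \in \operatorname{Im}(\Psi_D)$, i.e. there exist $n$, $a_1, \ldots, a_n \in A$ and $D_1, \ldots, D_n \in \mathscr{D}_A$ such that $D = \sum_{i=1}^n D(a_i) D_i$. *)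

theory Defs
  imports "HOL-Library.FuncSet" "HOL-Computational_Algebra.Polynomial"
begin

text \<open>
  A commutative \<open>k\<close>-algebra is given by a carrier \<open>A\<close> inside a commutative ring type, with scalar
  multiplication \<open>sc\<close>; \<open>A\<close> is meant to be closed under the ring operations and under \<open>sc\<close>.
  Operators on \<open>A\<close> are extensional functions (\<open>undefined\<close> outside \<open>A\<close>), so that equality
  of operators is equality of maps \<open>A \<rightarrow> A\<close>.
\<close>

definition is_subalgebra :: "('k::field \<Rightarrow> 'b::comm_ring_1 \<Rightarrow> 'b) \<Rightarrow> 'b set \<Rightarrow> bool" where
  "is_subalgebra sc A \<longleftrightarrow>
     1 \<in> A \<and> (\<forall>x\<in>A. \<forall>y\<in>A. x + y \<in> A \<and> x * y \<in> A) \<and> (\<forall>c. \<forall>x\<in>A. sc c x \<in> A)"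

definition linear_endos :: "('k::field \<Rightarrow> 'b::comm_ring_1 \<Rightarrow> 'b) \<Rightarrow> 'b set \<Rightarrow> ('b \<Rightarrow> 'b) set" where
  "linear_endos sc A =
     {D \<in> A \<rightarrow>\<^sub>E A. (\<forall>x\<in>A. \<forall>y\<in>A. D (x + y) = D x + D y) \<and>
                   (\<forall>c. \<forall>x\<in>A. D (sc c x) = sc c (D x))}"

text \<open>\<open>[D, a]\<close>, where \<open>a\<close> stands for the operator of multiplication by \<open>a\<close>.\<close>

definition op_commutator :: "'b::comm_ring_1 set \<Rightarrow> ('b \<Rightarrow> 'b) \<Rightarrow> 'b \<Rightarrow> ('b \<Rightarrow> 'b)" where
  "op_commutator A D a = (\<lambda>b\<in>A. D (a * b) - a * D b)"

text \<open>
  The index is shifted by one, because the order filtration starts at \<open>-1\<close>: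
  \<open>diff_ops_below sc A n\<close> consists of the operators of order at most \<open>n - 1\<close>.
\<close>

primrec diff_ops_below ::
  "('k::field \<Rightarrow> 'b::comm_ring_1 \<Rightarrow> 'b) \<Rightarrow> 'b set \<Rightarrow> nat \<Rightarrow> ('b \<Rightarrow> 'b) set" where
  "diff_ops_below sc A 0 = {\<lambda>b\<in>A. 0}"
| "diff_ops_below sc A (Suc n) =
     {D \<in> linear_endos sc A. \<forall>a\<in>A. op_commutator A D a \<in> diff_ops_below sc A n}"

definition diff_ops :: "('k::field \<Rightarrow> 'b::comm_ring_1 \<Rightarrow> 'b) \<Rightarrow> 'b set \<Rightarrow> ('b \<Rightarrow> 'b) set" where
  "diff_ops sc A = (\<Union>n. diff_ops_below sc A (Suc n))"

text \<open>
  The image of \<open>\<Psi>\<^sub>D : A \<otimes> \<D>\<^sub>A \<rightarrow> \<D>\<^sub>A\<close>, \<open>a \<otimes> E \<mapsto> D(a) E\<close>: every element of the tensor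
  product is a finite sum of elementary tensors.
\<close>

definition Psi_image ::
  "('k::field \<Rightarrow> 'b::comm_ring_1 \<Rightarrow> 'b) \<Rightarrow> 'b set \<Rightarrow> ('b \<Rightarrow> 'b) \<Rightarrow> ('b \<Rightarrow> 'b) set" where
  "Psi_image sc A D =
     {(\<lambda>x\<in>A. \<Sum>i<n. D (a i) * E i x) | (n::nat) a E.
        (\<forall>i<n. a i \<in> A) \<and> (\<forall>i<n. E i \<in> diff_ops sc A)}"

definition R_locally_projective ::
  "('k::field \<Rightarrow> 'b::comm_ring_1 \<Rightarrow> 'b) \<Rightarrow> 'b set \<Rightarrow> bool" where
  "R_locally_projective sc A \<longleftrightarrow> (\<forall>D\<in>diff_ops sc A. D \<in> Psi_image sc A D)"

text \<open>\<open>k + f k[t]\<close>\<close>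

definition const_plus_ideal :: "'k::field poly \<Rightarrow> 'k poly set" where
  "const_plus_ideal f = {[:c:] + f * g | c g. True}"

lemma is_subalgebra_const_plus_ideal: "is_subalgebra smult (const_plus_ideal f)"
proof -
  have mem: "p \<in> const_plus_ideal f \<longleftrightarrow> (\<exists>c. f dvd p - [:c:])" for p
  proof -
    have "p = [:c:] + f * g \<longleftrightarrow> p - [:c:] = f * g" for c g
      by (metis add.commute add_diff_cancel_right' diff_add_cancel)
    then show ?thesis
      unfolding const_plus_ideal_def dvd_def by simp
  qed
  have add: "x + y \<in> const_plus_ideal f" and mult: "x * y \<in> const_plus_ideal f"
    if "x \<in> const_plus_ideal f" "y \<in> const_plus_ideal f" for x y
  proof -
    from that obtain c d where cd: "f dvd x - [:c:]" "f dvd y - [:d:]"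
      unfolding mem by auto
    have "(x + y) - [:c + d:] = (x - [:c:]) + (y - [:d:])" by simp
    then have "f dvd (x + y) - [:c + d:]" using cd by (simp only: dvd_add)
    then show "x + y \<in> const_plus_ideal f" unfolding mem by (rule exI)
    have "x * y - [:c * d:] = (x - [:c:]) * y + [:c:] * (y - [:d:])"
      by (simp add: left_diff_distrib right_diff_distrib mult.commute)
    moreover have "f dvd (x - [:c:]) * y" "f dvd [:c:] * (y - [:d:])"
      using cd by (auto intro: dvd_mult dvd_mult2 simp del: mult_pCons_left)
    ultimately have "f dvd x * y - [:c * d:]" by (simp only: dvd_add)
    then show "x * y \<in> const_plus_ideal f" unfolding mem by (rule exI)
  qed
  have scale: "smult e x \<in> const_plus_ideal f" if x: "x \<in> const_plus_ideal f" for e x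
  proof -
    from x obtain c where c: "f dvd x - [:c:]" unfolding mem by auto
    have "smult e x - [:e * c:] = smult e (x - [:c:])" by (simp add: smult_diff_right)
    then have "f dvd smult e x - [:e * c:]" using c by (simp only: dvd_smult)
    then show ?thesis unfolding mem by (rule exI)
  qed
  have "f dvd 1 - [:1:]" by (simp add: one_pCons)
  then have "1 \<in> const_plus_ideal f" unfolding mem by (rule exI)
  then show ?thesis unfolding is_subalgebra_def by (simp add: add mult scale)
qed

end

theory Submission
  imports Defs "HOL-Computational_Algebra.Polynomial_Factorial"
begin

text \<open>
  The operator \<open>D = f \<partial>\<close> lies in \<open>\<D>\<^sub>A\<close>. If it were in the image of \<open>\<Psi>\<^sub>D\<close>, cancelling \<open>f\<close> would give
  \<open>g' = \<Sum> a\<^sub>i' E\<^sub>i(g)\<close> for all \<open>g \<in> A\<close>, with \<open>E\<^sub>i \<in> \<D>\<^sub>A\<close>. Write \<open>f = p q\<close> with \<open>p = f\<^sub>1\<close>. Differential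
  operators are continuous for the adic topology of each branch of the singular point: for large \<open>N\<close>,
  \<open>E\<^sub>i(p q\<^sup>N)\<close> is divisible by \<open>f\<^sub>2\<close>, and since it is congruent to a constant modulo \<open>f\<close>, it is
  divisible by \<open>f\<close>. Hence \<open>p\<close> divides the derivative of \<open>p q\<^sup>N\<close>, which is impossible because \<open>p\<close> is a
  simple factor.
\<close>

lemma ideal_subset_const_plus_ideal: "f dvd x \<Longrightarrow> x \<in> const_plus_ideal f"
  unfolding const_plus_ideal_def dvd_def by (auto intro: exI[of _ 0])

lemma prime_elem_degree_pos:
  fixes p :: "'k::field poly"
  assumes "prime_elem p"
  shows "degree p > 0"
  using is_unit_iff_degree[OF prime_elem_not_zeroI[OF assms]] prime_elem_not_unit[OF assms] by simp

text \<open>Modulo \<open>u\<close>, \<open>y\<close> reduces to its constant \<open>c\<close>;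
  hence the nonconstant \<open>u\<close> divides \<open>c\<close>, which forces
  \<open>c = 0\<close>.\<close>

lemma const_plus_ideal_dvd:
  fixes f u y :: "'k::field poly"
  assumes "y \<in> const_plus_ideal f" and "u dvd f" "u dvd y" "degree u > 0"
  shows "f dvd y"
proof -
  obtain c h where y: "y = [:c:] + f * h"
    using assms(1) unfolding const_plus_ideal_def by auto
  have "u dvd [:c:]"
    using assms(2,3) unfolding y by (metis dvd_add_left_iff dvd_mult2)
  then have "c = 0"
    using dvd_imp_degree_le[of u "[:c:]"] assms(4) by auto
  then show ?thesis by (simp add: y)
qed

text \<open>This is \<open>f\<close>-adic continuity: by D(f b) = [D, f](b) + f D(b), each step down
  the order filtration costs one power of \<open>f\<close>.\<close>

lemma diff_ops_below_dvd:
  assumes ideal: "\<And>y. f dvd y \<Longrightarrow> y \<in> A"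
    and "D \<in> diff_ops_below sc A n" and "f ^ (k + n) dvd y"
  shows "f ^ k dvd D y"
  using assms(2,3)
proof (induction n arbitrary: D y k)
  case 0
  \<comment> \<open>For \<open>k = 0\<close> the claim is trivial even if \<open>y\<close> lies
    outside \<open>A\<close>; otherwise \<open>y\<close> is in \<open>A\<close> and
    \<open>D y = 0\<close>.\<close>
  then show ?case
    by (cases k) (auto dest: dvd_mult_left intro!: ideal)
next
  case (Suc n)
  note IH = Suc.IH and D = \<open>D \<in> _\<close>
  from Suc.prems(2) show ?case
  proof (induction k arbitrary: y)
    case 0
    then show ?case by simp
  next
    case (Suc k)
    then obtain z where z: "y = f ^ (Suc k + Suc n) * z" by (auto elim: dvdE)
    define b where "b = f ^ (k + Suc n) * z"
    have y: "y = f * b" by (simp add: z b_def)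
    have "b \<in> A"
      by (rule ideal) (simp add: b_def)
    then have "op_commutator A D f b = D y - f * D b"
      by (simp add: op_commutator_def y)
    \<comment> \<open>\<open>b\<close> has one factor \<open>f\<close> fewer than \<open>y\<close>,
      but the commutator lies one step lower in the filtration:
      \<open>k + Suc n = Suc k + n\<close>.\<close>
    moreover have "f ^ Suc k dvd op_commutator A D f b"
      by (rule IH[of "op_commutator A D f" "Suc k" b]) (use D ideal[of f] in \<open>auto simp: b_def\<close>)
    moreover have "f ^ Suc k dvd f * D b"
      using Suc.IH[of b] by (simp add: b_def mult_dvd_mono)
    ultimately show ?case
      by (metis dvd_add diff_add_cancel)
  qed
qed

text \<open>When \<open>x\<close> itself lacks powers of \<open>f\<close>, a multiplier
  \<open>s\<close> can supply them: s D(x) = D(s x) - [D, s](x), where the first term is controlled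
  by continuity and the second by induction. Each step of the filtration uses one factor
  \<open>s\<close>.\<close>

lemma diff_ops_below_dvd_localized:
  assumes ideal: "\<And>y. f dvd y \<Longrightarrow> y \<in> A"
    and "D \<in> diff_ops_below sc A n" and s: "s \<in> A" and x: "x \<in> A"
    and "f ^ (k + n) dvd s * x"
  shows "f ^ k dvd s ^ n * D x"
  using assms(2,5)
proof (induction n arbitrary: D)
  case 0
  then show ?case using x by simp
next
  case (Suc n)
  have "f ^ k dvd s ^ n * op_commutator A D s x"
    by (rule Suc.IH) (use Suc.prems s in \<open>auto dest: dvd_mult_right\<close>)
  moreover have "op_commutator A D s x = D (s * x) - s * D x"
    using x by (simp add: op_commutator_def)
  ultimately have 1: "f ^ k dvd s ^ n * D (s * x) - s ^ Suc n * D x"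
    by (simp add: algebra_simps)
  have "f ^ k dvd s ^ n * D (s * x)"
    using diff_ops_below_dvd[OF ideal Suc.prems] by simp
  from dvd_diff[OF this 1] show ?case by simp
qed

text \<open>The value of \<open>E\<close> lies in the algebra, so divisibility by the single prime
  \<open>u\<close> already gives divisibility by \<open>p * q\<close>. As \<open>u\<close> does not
  divide \<open>p\<close>, powers of \<open>p\<close> do no harm.\<close>

lemma diff_ops_eventually_dvd:
  fixes p q u :: "'k::field poly"
  assumes E: "E \<in> diff_ops smult (const_plus_ideal (p * q))"
    and u: "prime_elem u" "u dvd q" "\<not> u dvd p" and q: "q \<noteq> 0"
  shows "\<forall>\<^sub>F N in sequentially. p * q dvd E (p * q ^ Suc N)"
proof -
  let ?A = "const_plus_ideal (p * q)"
  obtain m where m: "E \<in> diff_ops_below smult ?A (Suc m)"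
    using E unfolding diff_ops_def by blast
  define n where "n = Suc m"
  have En: "E \<in> diff_ops_below smult ?A n" using m by (simp add: n_def)
  have "p * q dvd E (p * q ^ Suc N)" if N: "N \<ge> 2 * n" for N
  proof -
    define x where "x = p * q ^ Suc N"
    \<comment> \<open>Supplies the powers of \<open>p\<close> that \<open>x\<close> lacks, at the cost of only one power of \<open>q\<close>.\<close>
    define s where "s = p ^ Suc (2 * n) * q"
    have x: "x \<in> ?A" and s: "s \<in> ?A"
      by (auto intro!: ideal_subset_const_plus_ideal simp: x_def s_def mult_dvd_mono)
    have "s * x = p ^ (Suc n + n) * q ^ (Suc n + n) * (p * q ^ (N - 2 * n) * q)"
      using N by (simp add: s_def x_def mult_ac flip: power_add mult_2)
    then have "(p * q) ^ (Suc n + n) dvd s * x"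
      by (simp only: power_mult_distrib dvd_triv_left)
    from diff_ops_below_dvd_localized[OF ideal_subset_const_plus_ideal En s x this]
    have "q ^ Suc n dvd s ^ n * E x"
      by (metis dvd_mult_right power_mult_distrib)
    \<comment> \<open>The explicit factor \<open>q\<close> of \<open>s\<close> contributes only
      \<open>q ^ n\<close> to \<open>s ^ n\<close>, so one factor \<open>q\<close> survives
      cancellation.\<close>
    then have "q ^ n * q dvd q ^ n * ((p ^ Suc (2 * n)) ^ n * E x)"
      by (simp add: s_def power_mult_distrib mult_ac)
    then have "q dvd (p ^ Suc (2 * n)) ^ n * E x"
      using q by (simp only: dvd_mult_cancel_left) simp
    then have "u dvd (p ^ Suc (2 * n)) ^ n * E x"
      using u(2) dvd_trans by blast
    then have "u dvd E x"
      using u(1,3) by (meson prime_elem_dvd_multD prime_elem_dvd_power)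
    moreover have "E x \<in> ?A"
      using m x by (auto simp: linear_endos_def)
    moreover have "degree u > 0"
      using u(1) by (rule prime_elem_degree_pos)
    ultimately show ?thesis
      using const_plus_ideal_dvd u(2) unfolding x_def by (metis dvd_mult)
  qed
  then show ?thesis
    unfolding eventually_sequentially by blast
qed

text \<open>The factor \<open>f\<close> keeps all values in the ideal, and the commutator with
  \<open>a\<close> is multiplication by \<open>f * pderiv a\<close>, so the order is at most
  1.\<close>

lemma f_pderiv_in_diff_ops:
  fixes f :: "'k::field poly"
  defines "A \<equiv> const_plus_ideal f"
  shows "(\<lambda>b\<in>A. f * pderiv b) \<in> diff_ops smult A"
proof -
  note [simp] = ideal_subset_const_plus_ideal
  have A: "x + y \<in> A" "x * y \<in> A" "smult c x \<in> A" if "x \<in> A" "y \<in> A" for x y c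
    using is_subalgebra_const_plus_ideal[of f] that unfolding A_def is_subalgebra_def by auto
  define D where "D = (\<lambda>b\<in>A. f * pderiv b)"
  have comm: "op_commutator A D a = (\<lambda>b\<in>A. f * pderiv a * b)" if "a \<in> A" for a
    using that A by (auto simp: op_commutator_def D_def pderiv_mult algebra_simps fun_eq_iff)
  have "(\<lambda>b\<in>A. f * pderiv a * b) \<in> diff_ops_below smult A (Suc 0)" if "a \<in> A" for a
    using that A
    by (auto simp: linear_endos_def op_commutator_def algebra_simps fun_eq_iff A_def)
  moreover have "D \<in> linear_endos smult A"
    using A by (auto simp: D_def linear_endos_def pderiv_add pderiv_smult algebra_simps A_def)
  ultimately have "D \<in> diff_ops_below smult A (Suc (Suc 0))"
    using comm by simp
  then show ?thesis unfolding diff_ops_def D_def by blast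
qed

theorem theorem3p3:
  fixes fs :: "nat \<Rightarrow> 'k::field_char_0 poly" and r :: nat
  assumes "r \<ge> 2"
    and "\<And>i. i \<in> {1..r} \<Longrightarrow> irreducible (fs i)"
    and "\<And>i j. i \<in> {1..r} \<Longrightarrow> j \<in> {1..r} \<Longrightarrow> i \<noteq> j \<Longrightarrow> coprime (fs i) (fs j)"
  shows "\<not> R_locally_projective smult (const_plus_ideal (\<Prod>i=1..r. fs i))"
proof
  define p q where "p = fs 1" and "q = (\<Prod>i=2..r. fs i)"
  define f where "f = p * q"
  have f: "(\<Prod>i=1..r. fs i) = f"
    using assms(1) by (simp add: f_def p_def q_def prod.atLeast_Suc_atMost numeral_2_eq_2)
  let ?A = "const_plus_ideal f"
  let ?D = "\<lambda>b\<in>?A. f * pderiv b"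
  assume "R_locally_projective smult (const_plus_ideal (\<Prod>i=1..r. fs i))"
  then have "?D \<in> Psi_image smult ?A ?D"
    using f_pderiv_in_diff_ops[of f] unfolding f R_locally_projective_def by blast
  then obtain n a E where aE: "\<And>i. i < n \<Longrightarrow> a i \<in> ?A" "\<And>i. i < n \<Longrightarrow> E i \<in> diff_ops smult ?A"
    and D: "?D = (\<lambda>x\<in>?A. \<Sum>i<(n::nat). ?D (a i) * E i x)"
    unfolding Psi_image_def by blast
  have prime: "prime_elem (fs i)" if "i \<in> {1..r}" for i
    using assms(2)[OF that] by (rule field_poly_irreducible_imp_prime)
  have ndvd: "\<not> fs i dvd fs j" if "i \<in> {1..r}" "j \<in> {1..r}" "i \<noteq> j" for i j
    using assms(3)[OF that] prime[OF that(1)] by (meson coprime_common_divisor dvd_refl prime_elem_not_unit)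
  have p: "prime_elem p" using prime[of 1] assms(1) by (simp add: p_def)
  have "fs i \<noteq> 0" if "i \<in> {2..r}" for i
    using prime_elem_not_zeroI[OF prime[of i]] that by simp
  then have q0: "q \<noteq> 0"
    unfolding q_def by simp
  have f0: "f \<noteq> 0" using p q0 by (auto simp: f_def)
  have pq: "\<not> p dvd q"
  proof
    have "\<not> p dvd prod fs S" if "finite S" "S \<subseteq> {2..r}" for S
      using that
    proof (induction S rule: finite_induct)
      case empty
      then show ?case using p by (simp add: prime_elem_not_unit)
    next
      case (insert i S)
      then show ?case
        using p ndvd[of 1 i] by (auto simp: p_def dest!: prime_elem_dvd_multD)
    qed
    moreover assume "p dvd q"
    ultimately show False unfolding q_def by blast
  qed
  have "\<forall>i\<in>{..<n}. \<forall>\<^sub>F N in sequentially. p * q dvd E i (p * q ^ Suc N)"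
  proof
    fix i assume "i \<in> {..<n}"
    \<comment> \<open>\<open>fs 2\<close> plays the role of \<open>u\<close>: it exists because
      \<open>r \<ge> 2\<close>, divides \<open>q\<close>, and does not divide
      \<open>p\<close>.\<close>
    then show "\<forall>\<^sub>F N in sequentially. p * q dvd E i (p * q ^ Suc N)"
      using aE(2)[of i] prime[of 2] ndvd[of 2 1] assms(1) q0
      by (intro diff_ops_eventually_dvd[of _ _ _ "fs 2"])
        (auto simp: f_def p_def q_def)
  qed
  \<comment> \<open>Only finitely many operators \<open>E i\<close> occur, so one \<open>N\<close>
    serves them all.\<close>
  then have "\<forall>\<^sub>F N in sequentially. \<forall>i\<in>{..<n}. p * q dvd E i (p * q ^ Suc N)"
    by (intro eventually_ball_finite) auto
  then obtain N where N: "\<And>i. i < n \<Longrightarrow> f dvd E i (p * q ^ Suc N)"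
    unfolding eventually_sequentially f_def by auto
  define g where "g = p * q ^ Suc N"
  have "g \<in> ?A"
    by (rule ideal_subset_const_plus_ideal) (simp add: g_def f_def)
  then have "f * pderiv g = (\<Sum>i<n. f * pderiv (a i) * E i g)"
    using fun_cong[OF D, of g] aE(1) by simp
  also have "\<dots> = f * (\<Sum>i<n. pderiv (a i) * E i g)"
    by (simp add: sum_distrib_left mult.assoc)
  finally have "pderiv g = (\<Sum>i<n. pderiv (a i) * E i g)"
    using f0 by simp
  moreover have "p dvd E i g" if "i < n" for i
    using N[OF that] unfolding g_def f_def by (rule dvd_mult_left)
  ultimately have "p dvd pderiv g"
    by (auto intro!: dvd_sum)
  moreover have "pderiv g = p * pderiv (q ^ Suc N) + pderiv p * q ^ Suc N"
    unfolding g_def by (simp only: pderiv_mult mult.commute)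
  ultimately have "p dvd pderiv p * q ^ Suc N"
    by (simp add: dvd_add_right_iff)
  then have "p dvd pderiv p"
    using p pq by (meson prime_elem_dvd_multD prime_elem_dvd_power)
  \<comment> \<open>In characteristic zero a nonconstant \<open>p\<close> has a nonzero derivative
    of smaller degree, which \<open>p\<close> cannot divide.\<close>
  moreover have "degree p \<noteq> 0"
    using prime_elem_degree_pos[OF p] by simp
  ultimately show False by simp
qed

end
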